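(* Let $a_2,a_3,a_4$ be integers with $1\le a_2\le a_3\le a_4$. The 4-Star Nim position $([1],[a_2],[a_3],[a_4])$ is a $\mathcal{P}$-position if and only if $a_2\oplus a_3\oplus a_4=0$.
   Context: $m$-Star Nim: $m$ strips of squares numbered $0,1,2,\ldots$ share their square $0$; each strip carries one token, and the shared square $0$ holds at most one token. A position is a tuple $([a_1],\ldots,[a_m])$ of nonnegative integers with at most one $a_i$ equal to $0$. A move replaces exactly one $a_i$ by a smaller nonnegative integer, provided the result is a legal position (so $a_i$ may be replaced by $0$ only if no other token is on square $0$). The game is impartial and a player unable to move loses. A $\mathcal{P}$-position is one from which the player about to move has no winning strategy; equivalently, its Sprague-Grundy value is $0$. $\oplus$ is Nim-sum (bitwise addition mod 2 of binary representations). *)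

theory Defs
  imports Complex_Main
begin

(* \<open>wins_with move \<sigma> p\<close>: in the game with move relation \<open>move\<close>, the positional strategy \<open>\<sigma>\<close>
   wins for the player about to move at \<open>p\<close>, the player unable to move losing. In particular
   \<open>\<sigma> p\<close> is a move available at \<open>p\<close>. Being inductive, it demands a win after finitely many moves. *)
inductive wins_with :: "('p \<Rightarrow> 'p \<Rightarrow> bool) \<Rightarrow> ('p \<Rightarrow> 'p) \<Rightarrow> 'p \<Rightarrow> bool"
  for move :: "'p \<Rightarrow> 'p \<Rightarrow> bool" and \<sigma> :: "'p \<Rightarrow> 'p"
where
  "\<lbrakk>move p (\<sigma> p); \<And>r. move (\<sigma> p) r \<Longrightarrow> wins_with move \<sigma> r\<rbrakk> \<Longrightarrow> wins_with move \<sigma> p"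

definition star_position :: "nat \<Rightarrow> nat list \<Rightarrow> bool" where
  "star_position m p \<longleftrightarrow> length p = m \<and> count_list p 0 \<le> 1"

definition star_move :: "nat \<Rightarrow> nat list \<Rightarrow> nat list \<Rightarrow> bool" where
  "star_move m p q \<longleftrightarrow> star_position m p \<and> star_position m q \<and>
     (\<exists>i<m. \<exists>b<p ! i. q = p[i := b])"

definition star_P_position :: "nat \<Rightarrow> nat list \<Rightarrow> bool" where
  "star_P_position m p \<longleftrightarrow> star_position m p \<and> \<not> (\<exists>\<sigma>. wins_with (star_move m) \<sigma> p)"

end

(* Once square 0 is occupied it stays so, and the remaining tokens play Nim with heaps a - 1.
   With a token on [1] and no token on square 0, three-heap Nim on a, b, c survives: removing
   the heap a from (a, b, b) leads to Nim with the equal heaps b - 1, b - 1, a P-position, while moving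
   [1] to [0] from a Nim-sum 0 position leads to heaps a - 1, b - 1, c - 1, whose Nim-sum is odd
   because an even number of a, b, c is odd. *)
theory Submission
  imports Defs
begin

text \<open>A player who always moves into \<open>K\<close> forces the opponent to leave it again,
  and the decreasing \<open>f\<close> makes play end. The move-closed region \<open>R\<close> allows
  \<open>K\<close> to be a kernel only there, not on all positions.\<close>

lemma wins_with_iff_not_kernel:
  fixes f :: "'p \<Rightarrow> nat"
  assumes closed: "\<And>p q. R p \<Longrightarrow> move p q \<Longrightarrow> R q"
    and decreasing: "\<And>p q. R p \<Longrightarrow> move p q \<Longrightarrow> f q < f p"
    and independent: "\<And>p q. R p \<Longrightarrow> K p \<Longrightarrow> move p q \<Longrightarrow> \<not> K q"
    and absorbing: "\<And>p. R p \<Longrightarrow> \<not> K p \<Longrightarrow> \<exists>q. move p q \<and> K q"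
    and "R p"
  shows "(\<exists>\<sigma>. wins_with move \<sigma> p) \<longleftrightarrow> \<not> K p"
proof
  assume "\<exists>\<sigma>. wins_with move \<sigma> p"
  then obtain \<sigma> where "wins_with move \<sigma> p" ..
  then show "\<not> K p" using \<open>R p\<close>
  proof induction
    case (1 p)
    \<comment> \<open>Otherwise \<open>absorbing\<close> would give the opponent a reply in
      \<open>K\<close>, against the induction hypothesis.\<close>
    then have "K (\<sigma> p)"
      using closed absorbing by meson
    with 1 show ?case using independent by blast
  qed
next
  define \<sigma> where "\<sigma> p = (SOME q. move p q \<and> K q)" for p
  have \<sigma>: "move p (\<sigma> p) \<and> K (\<sigma> p)" if "R p" "\<not> K p" for p
    unfolding \<sigma>_def by (rule someI_ex) (rule absorbing[OF that])
  assume "\<not> K p"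
  with \<open>R p\<close> have "wins_with move \<sigma> p"
  proof (induction "f p" arbitrary: p rule: less_induct)
    case less
    note s = \<sigma>[OF less.prems]
    have Rs: "R (\<sigma> p)" using closed less.prems(1) s by blast
    show ?case
    proof (rule wins_with.intros)
      show "move p (\<sigma> p)" using s by blast
      fix r assume r: "move (\<sigma> p) r"
      show "wins_with move \<sigma> r"
      proof (rule less.hyps)
        show "f r < f p" using decreasing[OF Rs r] decreasing[OF less.prems(1)] s by fastforce
        show "R r" using closed[OF Rs r] .
        show "\<not> K r" using independent[OF Rs _ r] s by blast
      qed
    qed
  qed
  then show "\<exists>\<sigma>. wins_with move \<sigma> p" by blast
qed

lemma xor_nat_eq_0_iff: "xor a b = 0 \<longleftrightarrow> a = b" for a b :: nat
  by (metis xor.assoc xor.left_neutral xor_self_eq xor.right_neutral)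

lemma xor_div_2: "xor a b div 2 = xor (a div 2) (b div 2)" for a b :: nat
  using drop_bit_xor[of 1 a b] by (simp add: drop_bit_eq_div)

text \<open>Halving drops the lowest binary digit. If the halves have nonzero Nim-sum, a strict
  inequality between halves lifts to the heaps; otherwise only the lowest digit matters.\<close>

lemma nim_three_heaps_move:
  fixes x y z :: nat
  assumes "xor (xor x y) z \<noteq> 0"
  shows "xor y z < x \<or> xor x z < y \<or> xor x y < z"
  using assms
proof (induction "x + y + z" arbitrary: x y z rule: less_induct)
  case less
  let ?x = "x div 2" and ?y = "y div 2" and ?z = "z div 2"
  show ?case
  proof (cases "xor (xor ?x ?y) ?z = 0")
    case True
    then have eqs: "xor ?y ?z = ?x" "xor ?x ?z = ?y" "xor ?x ?y = ?z"
      by (metis xor_nat_eq_0_iff xor.assoc xor.commute)+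
    have "xor (xor x y) z div 2 = 0"
      using True by (simp add: xor_div_2)
    with less.prems have "odd (xor (xor x y) z)"
      by presburger
    \<comment> \<open>One or all three heaps are odd. Either way the other two have even Nim-sum,
      which has the same half as the odd heap and so lies just below it.\<close>
    then consider "odd x" "even (xor y z)" | "odd y" "even (xor x z)" | "odd z" "even (xor x y)"
      by (auto simp: even_xor_iff)
    moreover have "m < n" if "odd n" "even m" "m div 2 = n div 2" for m n :: nat
      using that by presburger
    ultimately show ?thesis using eqs by (metis xor_div_2)
  next
    case False
    then have "x + y + z \<noteq> 0" by (intro notI) auto
    then have "?x + ?y + ?z < x + y + z" by linarith
    from less.hyps[OF this False]
    have "xor y z div 2 < x div 2 \<or> xor x z div 2 < y div 2 \<or> xor x y div 2 < z div 2"
      by (simp add: xor_div_2)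
    then show ?thesis by (meson div_le_mono leD not_less)
  qed
qed

text \<open>The first token is meant to be on square 0 or 1, so it contributes 0 to the Nim-sum of
  the decremented entries; for the entry 0, truncated subtraction gives the required empty heap.\<close>
fun star_kernel :: "nat list \<Rightarrow> bool" where
  "star_kernel [w, a, b, c] \<longleftrightarrow>
     (if 0 \<in> {w, a, b, c} then xor (xor (a - 1) (b - 1)) (c - 1) = 0
      else xor (xor a b) c = 0)"
| "star_kernel _ \<longleftrightarrow> False"

lemma star_move_4_iff:
  "star_move 4 [w, a, b, c] q \<longleftrightarrow> star_position 4 [w, a, b, c] \<and> star_position 4 q \<and>
     ((\<exists>k<w. q = [k, a, b, c]) \<or> (\<exists>k<a. q = [w, k, b, c]) \<or>
      (\<exists>k<b. q = [w, a, k, c]) \<or> (\<exists>k<c. q = [w, a, b, k]))"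
proof -
  have "(\<exists>i<4. P i) \<longleftrightarrow> P 0 \<or> P 1 \<or> P 2 \<or> P 3" for P :: "nat \<Rightarrow> bool"
    by (auto simp: numeral_eq_Suc less_Suc_eq)
  then show ?thesis
    by (simp add: star_move_def numeral_eq_Suc)
qed

lemma xor_three_cancel:
  fixes a b c d :: nat
  shows "xor (xor a b) c = xor (xor d b) c \<longleftrightarrow> a = d"
    and "xor (xor a b) c = xor (xor a d) c \<longleftrightarrow> b = d"
    and "xor (xor a b) c = xor (xor a b) d \<longleftrightarrow> c = d"
  by (metis xor_nat_eq_0_iff xor.assoc xor.commute)+

text \<open>Decrementing three positive entries flips three parities, hence the parity of the
  Nim-sum.\<close>

lemma xor_predecessors_neq_0:
  fixes a b c :: nat
  assumes "a > 0" "b > 0" "c > 0" "xor (xor a b) c = 0"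
  shows "xor (xor (a - 1) (b - 1)) (c - 1) \<noteq> 0"
proof
  assume "xor (xor (a - 1) (b - 1)) (c - 1) = 0"
  then have "even (xor (xor (a - 1) (b - 1)) (c - 1))" by simp
  moreover have "even (xor (xor a b) c)" using assms by simp
  ultimately show False using assms(1-3) by (auto simp: even_xor_iff)
qed

lemma star_kernel_independent:
  assumes "w \<le> 1" "star_kernel [w, a, b, c]" "star_move 4 [w, a, b, c] q"
  shows "\<not> star_kernel q"
proof
  assume q: "star_kernel q"
  from assms(3) have pos: "star_position 4 [w, a, b, c]" "star_position 4 q"
    by (simp_all add: star_move_def)
  have pred: "m - 1 = n - 1 \<longleftrightarrow> m = n" if "0 < m" "0 < n" for m n :: nat
    using that by linarith
  from assms(3) consider
      k where "k < w" "q = [k, a, b, c]"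
    | k where "k < a" "q = [w, k, b, c]"
    | k where "k < b" "q = [w, a, k, c]"
    | k where "k < c" "q = [w, a, b, k]"
    by (auto simp: star_move_4_iff)
  then show False
  proof cases
    case 1
    with assms(1) have "q = [0, a, b, c]" "w = 1" by auto
    then show False
      using assms(2) q pos xor_predecessors_neq_0[of a b c]
      by (auto simp: star_position_def split: if_splits)
  next
    \<comment> \<open>If the move does not newly occupy square 0, both Nim-sums are of the same kind
      and cancellation gives \<open>k = a\<close>; \<open>pred\<close> applies since at most one
      entry is 0. If it does, \<open>k = 0\<close> and \<open>b - 1 = c - 1\<close>, so
      \<open>b = c\<close> and the old Nim-sum would be \<open>a > 0\<close>. The next two cases are
      symmetric.\<close>
    case 2
    then show False
      using assms(2) q pos pred[of k a] pred[of b c] xor_three_cancel(1)[of a b c k]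
        xor_three_cancel(1)[of "a - 1" "b - 1" "c - 1" "k - 1"]
      by (auto simp: star_position_def xor_nat_eq_0_iff split: if_splits)
  next
    case 3
    then show False
      using assms(2) q pos pred[of k b] pred[of a c] xor_three_cancel(2)[of a b c k]
        xor_three_cancel(2)[of "a - 1" "b - 1" "c - 1" "k - 1"]
      by (auto simp: star_position_def xor_nat_eq_0_iff split: if_splits)
  next
    case 4
    then show False
      using assms(2) q pos pred[of k c] pred[of a b] xor_three_cancel(3)[of a b c k]
        xor_three_cancel(3)[of "a - 1" "b - 1" "c - 1" "k - 1"]
      by (auto simp: star_position_def xor_nat_eq_0_iff split: if_splits)
  qed
qed

text \<open>The first token can stay put: a winning move of three-heap Nim serves as reply, on the
  decremented heaps if square 0 is occupied and on \<open>a\<close>, \<open>b\<close>,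
  \<open>c\<close> otherwise.\<close>

lemma star_kernel_absorbing:
  assumes "w \<le> 1" "star_position 4 [w, a, b, c]" "\<not> star_kernel [w, a, b, c]"
  shows "\<exists>q. star_move 4 [w, a, b, c] q \<and> star_kernel q"
proof -
  have cancel: "xor (xor (xor y z) y) z = 0" "xor (xor x (xor x z)) z = 0"
    "xor (xor x y) (xor x y) = 0" for x y z :: nat
    by (metis xor_nat_eq_0_iff xor.assoc xor.commute)+
  show ?thesis
  proof (cases "0 \<in> {w, a, b, c}")
    case True
    let ?a = "a - 1" and ?b = "b - 1" and ?c = "c - 1"
    from True assms(3) have "xor (xor ?a ?b) ?c \<noteq> 0" by simp
    then consider "xor ?b ?c < ?a" | "xor ?a ?c < ?b" | "xor ?a ?b < ?c"
      using nim_three_heaps_move by blast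
    then show ?thesis
    proof cases
      case 1
      \<comment> \<open>\<open>Suc\<close> turns a heap back into a square number, so the moved
        token avoids square 0. As \<open>a > 0\<close>, the token on square 0 is another one and
        remains there.\<close>
      then have "star_move 4 [w, a, b, c] [w, Suc (xor ?b ?c), b, c]"
        using assms(2) by (auto simp: star_move_4_iff star_position_def split: if_splits)
      moreover have "star_kernel [w, Suc (xor ?b ?c), b, c]"
        using 1 True cancel(1) by auto
      ultimately show ?thesis by blast
    next
      case 2
      then have "star_move 4 [w, a, b, c] [w, a, Suc (xor ?a ?c), c]"
        using assms(2) by (auto simp: star_move_4_iff star_position_def split: if_splits)
      moreover have "star_kernel [w, a, Suc (xor ?a ?c), c]"
        using 2 True cancel(2) by auto
      ultimately show ?thesis by blast
    next
      case 3
      then have "star_move 4 [w, a, b, c] [w, a, b, Suc (xor ?a ?b)]"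
        using assms(2) by (auto simp: star_move_4_iff star_position_def split: if_splits)
      moreover have "star_kernel [w, a, b, Suc (xor ?a ?b)]"
        using 3 True cancel(3) by auto
      ultimately show ?thesis by blast
    qed
  next
    case False
    with assms(3) have "xor (xor a b) c \<noteq> 0" by auto
    then consider "xor b c < a" | "xor a c < b" | "xor a b < c"
      using nim_three_heaps_move by blast
    then show ?thesis
    proof cases
      case 1
      then have "star_move 4 [w, a, b, c] [w, xor b c, b, c]"
        using False by (auto simp: star_move_4_iff star_position_def)
      \<comment> \<open>The new entry is 0 exactly when \<open>b = c\<close>. The kernel then
        switches to the decremented heaps, where \<open>b - 1 = c - 1\<close> again gives Nim-sum
        0.\<close>
      moreover have "star_kernel [w, xor b c, b, c]"
        using False cancel(1)[of b c] by (auto simp: xor_nat_eq_0_iff)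
      ultimately show ?thesis by blast
    next
      case 2
      then have "star_move 4 [w, a, b, c] [w, a, xor a c, c]"
        using False by (auto simp: star_move_4_iff star_position_def)
      moreover have "star_kernel [w, a, xor a c, c]"
        using False cancel(2)[of a c] by (auto simp: xor_nat_eq_0_iff)
      ultimately show ?thesis by blast
    next
      case 3
      then have "star_move 4 [w, a, b, c] [w, a, b, xor a b]"
        using False by (auto simp: star_move_4_iff star_position_def)
      moreover have "star_kernel [w, a, b, xor a b]"
        using False cancel(3)[of a b] by (auto simp: xor_nat_eq_0_iff)
      ultimately show ?thesis by blast
    qed
  qed
qed

theorem proposition3:
  fixes a2 a3 a4 :: nat
  assumes "1 \<le> a2" and "a2 \<le> a3" and "a3 \<le> a4"
  shows "star_P_position 4 [1, a2, a3, a4] \<longleftrightarrow> xor (xor a2 a3) a4 = 0"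
proof -
  \<comment> \<open>Moves only lower entries, so the bound \<open>w \<le> 1\<close> persists
    throughout play.\<close>
  define R where
    "R p \<longleftrightarrow> star_position 4 p \<and> (\<exists>w a b c. p = [w, a, b, c] \<and> w \<le> 1)" for p
  have pos: "star_position 4 [1, a2, a3, a4]"
    using assms by (simp add: star_position_def)
  have "(\<exists>\<sigma>. wins_with (star_move 4) \<sigma> [1, a2, a3, a4]) \<longleftrightarrow> \<not> star_kernel [1, a2, a3, a4]"
  proof (rule wins_with_iff_not_kernel[where R = R and f = sum_list])
    show "R q" if "R p" "star_move 4 p q" for p q
      using that by (auto simp: R_def star_move_4_iff)
    show "sum_list q < sum_list p" if "R p" "star_move 4 p q" for p q
      using that by (auto simp: R_def star_move_4_iff)
    show "\<not> star_kernel q" if "R p" "star_kernel p" "star_move 4 p q" for p q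
      using that star_kernel_independent by (auto simp only: R_def)
    show "\<exists>q. star_move 4 p q \<and> star_kernel q" if "R p" "\<not> star_kernel p" for p
      using that star_kernel_absorbing by (auto simp only: R_def)
    show "R [1, a2, a3, a4]" using pos by (simp add: R_def)
  qed
  \<comment> \<open>All entries are positive here, so \<open>star_kernel\<close> reduces to the
    Nim-sum of \<open>a2\<close>, \<open>a3\<close>, \<open>a4\<close>.\<close>
  with pos show ?thesis using assms by (simp add: star_P_position_def)
qed

end
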